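(* Let $(\mathcal{H},[\cdot,\cdot])$ be a Krein space with fundamental symmetry $J$ and let $\mathcal{F}=\{f_i\}_{i\in I}$ be a $J$-frame for $\mathcal{H}$. Let $I_+=\{i\in I:[f_i,f_i]\ge0\}$, $I_-=\{i\in I:[f_i,f_i]<0\}$ and $\mathcal{M}_\pm=\overline{\mathrm{span}\{f_i:i\in I_\pm\}}$. Then $\mathcal{F}_\pm=\{f_i\}_{i\in I_\pm}$ is a frame for the Hilbert space $(\mathcal{M}_\pm,\pm[\cdot,\cdot])$, i.e. there exist constants $B_-\le A_-<0<A_+\le B_+$ such that \[ A_\pm[f,f]\le\sum_{i\in I_\pm}|[f,f_i]|^2\le B_\pm[f,f]\qquad\text{for every } f\in\mathcal{M}_\pm . \]
   Context: Krein space setting: $(\mathcal{H},[\cdot,\cdot])$ is a complex separable Krein space with a fixed fundamental decomposition $\mathcal{H}=\mathcal{H}_+\dotplus\mathcal{H}_-$ (the summands are $[\cdot,\cdot]$-orthogonal and $(\mathcal{H}_\pm,\pm[\cdot,\cdot])$ are Hilbert spaces). $\langle\cdot,\cdot\rangle$ is the inner product making $\mathcal{H}$ the orthogonal direct sum of these Hilbert spaces, $\|\cdot\|$ its norm, and the fundamental symmetry $J$ (a selfadjoint unitary) satisfies $[x,y]=\langle Jx,y\rangle$. Closures are taken in $\|\cdot\|$. A subspace $\mathcal{S}$ is uniformly $J$-positive (resp. uniformly $J$-negative) if there is $\alpha>0$ with $[x,x]\ge\alpha\|x\|^2$ (resp. $[x,x]\le-\alpha\|x\|^2$) for all $x\in\mathcal{S}$.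 "Maximal" means maximal with respect to inclusion among such subspaces. If $\mathcal{S}$ is a closed uniformly $J$-positive (resp. $J$-negative) subspace, $(\mathcal{S},[\cdot,\cdot])$ (resp. $(\mathcal{S},-[\cdot,\cdot])$) is a Hilbert space. A Bessel family is a family $\mathcal{F}=\{f_i\}_{i\in I}$ in $\mathcal{H}$ with $\sum_i|\langle f,f_i\rangle|^2\le B\|f\|^2$ for all $f$ and some $B<\infty$. Its synthesis operator is the bounded operator $T:\ell_2(I)\to\mathcal{H}$, $Te_i=f_i$, with $\{e_i\}$ the standard orthonormal basis. With $I_\pm$ as in the claim, let $P_\pm$ be the orthogonal projection of $\ell_2(I)$ onto $\ell_2(I_\pm)$ and $T_\pm=TP_\pm$. The Bessel family $\mathcal{F}$ is a $J$-frame for $\mathcal{H}$ if the range $R(T_+)$ is a maximal uniformly $J$-positive subspace and $R(T_-)$ is a maximal uniformly $J$-negative subspace of $\mathcal{H}$. *)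

theory Defs
  imports "HOL-Analysis.Analysis"
begin

section \<open>Hilbert spaces inside a space with a Hermitian form\<close>

text \<open>Sesquilinear forms are linear in the first and conjugate-linear in the second argument.
  A Hermitian form is real on the diagonal, so an order statement about \<open>q x x\<close> is
  written with \<open>Re (q x x)\<close>.\<close>

definition hermitian_form ::
    "(complex \<Rightarrow> 'h \<Rightarrow> 'h) \<Rightarrow> ('h::ab_group_add \<Rightarrow> 'h \<Rightarrow> complex) \<Rightarrow> bool" where
  "hermitian_form scl q \<longleftrightarrow>
     (\<forall>x y z. q (x + y) z = q x z + q y z) \<and>
     (\<forall>a x y. q (scl a x) y = a * q x y) \<and>
     (\<forall>x y. q y x = cnj (q x y))"

definition inner_product_on ::
    "(complex \<Rightarrow> 'h \<Rightarrow> 'h) \<Rightarrow> ('h::ab_group_add \<Rightarrow> 'h \<Rightarrow> complex) \<Rightarrow> 'h set \<Rightarrow> bool" where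
  "inner_product_on scl q S \<longleftrightarrow>
     hermitian_form scl q \<and> module.subspace scl S \<and> (\<forall>x\<in>S. x \<noteq> 0 \<longrightarrow> 0 < Re (q x x))"

text \<open>The absolute value has no effect on a subspace where \<open>q\<close> is positive definite.
  It is there because \<open>Metric_space\<close> asks for nonnegativity also outside the carrier.\<close>

definition form_norm :: "('h \<Rightarrow> 'h \<Rightarrow> complex) \<Rightarrow> 'h \<Rightarrow> real" where
  "form_norm q x = sqrt \<bar>Re (q x x)\<bar>"

definition form_dist :: "('h::ab_group_add \<Rightarrow> 'h \<Rightarrow> complex) \<Rightarrow> 'h \<Rightarrow> 'h \<Rightarrow> real" where
  "form_dist q x y = form_norm q (x - y)"

definition hilbert_on ::
    "(complex \<Rightarrow> 'h \<Rightarrow> 'h) \<Rightarrow> ('h::ab_group_add \<Rightarrow> 'h \<Rightarrow> complex) \<Rightarrow> 'h set \<Rightarrow> bool" where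
  "hilbert_on scl q S \<longleftrightarrow>
     inner_product_on scl q S \<and> Metric_space.mcomplete S (form_dist q)"

lemma inner_product_on_Metric_space:
  assumes "vector_space scl" and ip: "inner_product_on scl q S"
  shows "Metric_space S (form_dist q)"
proof -
  interpret vector_space scl by fact
  have sub: "subspace S" and pd: "\<And>x. x \<in> S \<Longrightarrow> x \<noteq> 0 \<Longrightarrow> 0 < Re (q x x)"
    and add: "\<And>x y z. q (x + y) z = q x z + q y z"
    and sc: "\<And>a x y. q (scl a x) y = a * q x y"
    and herm: "\<And>x y. q y x = cnj (q x y)"
    using ip unfolding inner_product_on_def hermitian_form_def by blast+
  have q0: "q 0 x = 0" "q x 0 = 0" for x
    using add[of 0 0 x] herm[of 0 x] by simp_all
  have nn: "0 \<le> Re (q x x)" if "x \<in> S" for x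
    using pd[OF that] q0 by (cases "x = 0") auto
  have addr: "q x (y + z) = q x y + q x z" for x y z
    by (subst (1 2 3) herm) (simp add: add)
  have scr: "q x (scl a y) = cnj a * q x y" for a x y
    by (subst (1 2) herm) (simp add: sc)
  have expand: "Re (q (x + scl (of_real t) y) (x + scl (of_real t) y))
      = Re (q x x) + 2 * t * Re (q x y) + t\<^sup>2 * Re (q y y)" for x y t
  proof -
    have "Re (q y x) = Re (q x y)" using herm[of x y] by simp
    then show ?thesis
      by (simp add: add addr sc scr power2_eq_square algebra_simps)
  qed
  have CS: "Re (q x y) \<le> form_norm q x * form_norm q y" if xy: "x \<in> S" "y \<in> S" for x y
  proof (cases "y = 0")
    case True
    then show ?thesis by (simp add: form_norm_def q0)
  next
    case False
    let ?c = "Re (q y y)" and ?b = "Re (q x y)"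
    have c: "?c > 0" using pd xy False by blast
    define t where "t = - ?b / ?c"
    have mem: "x + scl (of_real t) y \<in> S"
      using xy subspace_add[OF sub] subspace_scale[OF sub] by blast
    have "0 \<le> Re (q x x) + 2 * t * ?b + t\<^sup>2 * ?c"
      using nn[OF mem] expand by simp
    also have "\<dots> = Re (q x x) - ?b\<^sup>2 / ?c"
      using c by (simp add: t_def power2_eq_square field_simps)
    finally have "?b\<^sup>2 \<le> Re (q x x) * ?c"
      using c by (simp add: field_simps)
    then have "\<bar>?b\<bar> \<le> sqrt (Re (q x x) * ?c)"
      using real_le_rsqrt by fastforce
    then show ?thesis using nn xy by (simp add: form_norm_def real_sqrt_mult)
  qed
  have tri: "form_norm q (x + y) \<le> form_norm q x + form_norm q y" if xy: "x \<in> S" "y \<in> S" for x y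
  proof -
    have "(form_norm q (x + y))\<^sup>2 = Re (q (x + y) (x + y))"
      using nn subspace_add[OF sub xy] by (simp add: form_norm_def)
    also have "\<dots> = Re (q x x) + 2 * Re (q x y) + Re (q y y)"
      using expand[of x 1 y] by simp
    also have "\<dots> \<le> (form_norm q x + form_norm q y)\<^sup>2"
      using CS[OF xy] nn xy by (simp add: form_norm_def power2_sum)
    finally show ?thesis
      by (rule power2_le_imp_le) (simp add: form_norm_def)
  qed
  show ?thesis
  proof
    show "0 \<le> form_dist q x y" for x y
      by (simp add: form_dist_def form_norm_def)
    show "form_dist q x y = form_dist q y x" for x y
    proof -
      have "q (scl (-1) (x - y)) (scl (-1) (x - y)) = q (x - y) (x - y)"
        by (simp only: sc scr) simp
      moreover have "scl (-1) (x - y) = y - x" by simp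
      ultimately have "q (y - x) (y - x) = q (x - y) (x - y)" by (simp only:)
      then show ?thesis unfolding form_dist_def form_norm_def by (simp only:)
    qed
    show "form_dist q x y = 0 \<longleftrightarrow> x = y" if "x \<in> S" "y \<in> S" for x y
      using pd[OF subspace_diff[OF sub that]] q0
      by (cases "x = y") (auto simp: form_dist_def form_norm_def)
    show "form_dist q x z \<le> form_dist q x y + form_dist q y z"
      if "x \<in> S" "y \<in> S" "z \<in> S" for x y z
      using tri[OF subspace_diff[OF sub that(1,2)] subspace_diff[OF sub that(2,3)]]
      by (simp add: form_dist_def)
  qed
qed


section \<open>The space \<open>\<ell>\<^sub>2(I)\<close>\<close>

text \<open>Elements are functions on the whole index type that vanish off \<open>I\<close>, so that
  \<open>l2 K \<subseteq> l2 I\<close> for \<open>K \<subseteq> I\<close>.\<close>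

definition l2 :: "'i set \<Rightarrow> ('i \<Rightarrow> complex) set" where
  "l2 I = {c. (\<forall>i. i \<notin> I \<longrightarrow> c i = 0) \<and> (\<lambda>i. (cmod (c i))\<^sup>2) summable_on I}"

definition l2_inner :: "'i set \<Rightarrow> ('i \<Rightarrow> complex) \<Rightarrow> ('i \<Rightarrow> complex) \<Rightarrow> complex" where
  "l2_inner I c d = (\<Sum>\<^sub>\<infinity>i\<in>I. c i * cnj (d i))"

definition l2_norm :: "'i set \<Rightarrow> ('i \<Rightarrow> complex) \<Rightarrow> real" where
  "l2_norm I c = sqrt (\<Sum>\<^sub>\<infinity>i\<in>I. (cmod (c i))\<^sup>2)"

definition l2_unit :: "'i \<Rightarrow> 'i \<Rightarrow> complex" where
  "l2_unit i = (\<lambda>j. if j = i then 1 else 0)"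

definition l2_proj :: "'i set \<Rightarrow> ('i \<Rightarrow> complex) \<Rightarrow> ('i \<Rightarrow> complex)" where
  "l2_proj K c = (\<lambda>i. if i \<in> K then c i else 0)"

lemma l2_proj_orthogonal_projection:
  assumes "K \<subseteq> I" "c \<in> l2 I"
  shows "l2_proj K c \<in> l2 K"
    and "d \<in> l2 K \<Longrightarrow> l2_inner I (\<lambda>i. c i - l2_proj K c i) d = 0"
proof -
  have "(\<lambda>i. (cmod (c i))\<^sup>2) summable_on K"
    using assms summable_on_subset_banach by (auto simp: l2_def)
  then show "l2_proj K c \<in> l2 K"
    by (auto simp: l2_def l2_proj_def cong: summable_on_cong)
  show "l2_inner I (\<lambda>i. c i - l2_proj K c i) d = 0" if "d \<in> l2 K"
    unfolding l2_inner_def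
    by (rule infsum_0) (use that in \<open>auto simp: l2_def l2_proj_def\<close>)
qed


section \<open>Krein spaces with a fixed fundamental decomposition\<close>

locale krein_space = vector_space scl
  for scl :: "complex \<Rightarrow> 'h::ab_group_add \<Rightarrow> 'h" +
  fixes bracket :: "'h \<Rightarrow> 'h \<Rightarrow> complex"
    and Hpos Hneg :: "'h set"
  assumes hermitian: "hermitian_form scl bracket"
    and hilbert_pos: "hilbert_on scl bracket Hpos"
    and hilbert_neg: "hilbert_on scl (\<lambda>x y. - bracket x y) Hneg"
    and bracket_orthogonal: "\<lbrakk>x \<in> Hpos; y \<in> Hneg\<rbrakk> \<Longrightarrow> bracket x y = 0"
    and direct: "Hpos \<inter> Hneg = {0}"
    and decomposition: "\<exists>p\<in>Hpos. \<exists>m\<in>Hneg. x = p + m"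
begin

definition part_pos :: "'h \<Rightarrow> 'h" where
  "part_pos x = (THE p. p \<in> Hpos \<and> x - p \<in> Hneg)"

definition part_neg :: "'h \<Rightarrow> 'h" where
  "part_neg x = x - part_pos x"

definition fundamental_symmetry :: "'h \<Rightarrow> 'h" where
  "fundamental_symmetry x = part_pos x - part_neg x"

definition kinner :: "'h \<Rightarrow> 'h \<Rightarrow> complex" where
  "kinner x y = bracket (part_pos x) (part_pos y) - bracket (part_neg x) (part_neg y)"

abbreviation knorm :: "'h \<Rightarrow> real" where
  "knorm \<equiv> form_norm kinner"

definition ktopology :: "'h topology" where
  "ktopology = Metric_space.mtopology UNIV (form_dist kinner)"

definition uniformly_J_positive :: "'h set \<Rightarrow> bool" where
  "uniformly_J_positive S \<longleftrightarrow>
     subspace S \<and> (\<exists>\<alpha>>0. \<forall>x\<in>S. \<alpha> * (knorm x)\<^sup>2 \<le> Re (bracket x x))"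

definition uniformly_J_negative :: "'h set \<Rightarrow> bool" where
  "uniformly_J_negative S \<longleftrightarrow>
     subspace S \<and> (\<exists>\<alpha>>0. \<forall>x\<in>S. Re (bracket x x) \<le> - \<alpha> * (knorm x)\<^sup>2)"

definition maximal_uniformly_J_positive :: "'h set \<Rightarrow> bool" where
  "maximal_uniformly_J_positive S \<longleftrightarrow>
     uniformly_J_positive S \<and> (\<forall>S'. uniformly_J_positive S' \<and> S \<subseteq> S' \<longrightarrow> S' = S)"

definition maximal_uniformly_J_negative :: "'h set \<Rightarrow> bool" where
  "maximal_uniformly_J_negative S \<longleftrightarrow>
     uniformly_J_negative S \<and> (\<forall>S'. uniformly_J_negative S' \<and> S \<subseteq> S' \<longrightarrow> S' = S)"

definition I_pos :: "'i set \<Rightarrow> ('i \<Rightarrow> 'h) \<Rightarrow> 'i set" where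
  "I_pos I f = {i \<in> I. 0 \<le> Re (bracket (f i) (f i))}"

definition I_neg :: "'i set \<Rightarrow> ('i \<Rightarrow> 'h) \<Rightarrow> 'i set" where
  "I_neg I f = {i \<in> I. Re (bracket (f i) (f i)) < 0}"

definition M_pos :: "'i set \<Rightarrow> ('i \<Rightarrow> 'h) \<Rightarrow> 'h set" where
  "M_pos I f = ktopology closure_of (span (f ` I_pos I f))"

definition M_neg :: "'i set \<Rightarrow> ('i \<Rightarrow> 'h) \<Rightarrow> 'h set" where
  "M_neg I f = ktopology closure_of (span (f ` I_neg I f))"

definition bessel_family :: "'i set \<Rightarrow> ('i \<Rightarrow> 'h) \<Rightarrow> bool" where
  "bessel_family I f \<longleftrightarrow>
     (\<exists>B. \<forall>x. (\<lambda>i. (cmod (kinner x (f i)))\<^sup>2) summable_on I \<and>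
               (\<Sum>\<^sub>\<infinity>i\<in>I. (cmod (kinner x (f i)))\<^sup>2) \<le> B * (knorm x)\<^sup>2)"

text \<open>These conditions determine \<open>T\<close> on \<open>l2 I\<close>; its values elsewhere are never used.\<close>

definition synthesis_operator :: "'i set \<Rightarrow> ('i \<Rightarrow> 'h) \<Rightarrow> (('i \<Rightarrow> complex) \<Rightarrow> 'h) \<Rightarrow> bool" where
  "synthesis_operator I f T \<longleftrightarrow>
     (\<forall>c\<in>l2 I. \<forall>d\<in>l2 I. T (\<lambda>i. c i + d i) = T c + T d) \<and>
     (\<forall>a. \<forall>c\<in>l2 I. T (\<lambda>i. a * c i) = scl a (T c)) \<and>
     (\<exists>C. \<forall>c\<in>l2 I. knorm (T c) \<le> C * l2_norm I c) \<and>
     (\<forall>i\<in>I. T (l2_unit i) = f i)"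

definition J_frame :: "'i set \<Rightarrow> ('i \<Rightarrow> 'h) \<Rightarrow> bool" where
  "J_frame I f \<longleftrightarrow>
     bessel_family I f \<and>
     (\<exists>T. synthesis_operator I f T \<and>
          maximal_uniformly_J_positive ((T \<circ> l2_proj (I_pos I f)) ` l2 I) \<and>
          maximal_uniformly_J_negative ((T \<circ> l2_proj (I_neg I f)) ` l2 I))"

lemma bracket_commute: "bracket y x = cnj (bracket x y)"
  using hermitian unfolding hermitian_form_def by blast

lemma bracket_simps:
  shows bracket_add_left: "bracket (x + y) z = bracket x z + bracket y z"
    and bracket_scale_left: "bracket (scl a x) y = a * bracket x y"
    and bracket_add_right: "bracket z (x + y) = bracket z x + bracket z y"
    and bracket_scale_right: "bracket y (scl a x) = cnj a * bracket y x"
proof -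
  show add: "bracket (x + y) z = bracket x z + bracket y z" for x y z
    using hermitian unfolding hermitian_form_def by blast
  show scale: "bracket (scl a x) y = a * bracket x y" for a x y
    using hermitian unfolding hermitian_form_def by blast
  show "bracket z (x + y) = bracket z x + bracket z y"
    by (subst (1 2 3) bracket_commute) (simp add: add)
  show "bracket y (scl a x) = cnj a * bracket y x"
    by (subst (1 2) bracket_commute) (simp add: scale)
qed

lemma subspace_Hpos: "subspace Hpos" and subspace_Hneg: "subspace Hneg"
  using hilbert_pos hilbert_neg by (simp_all add: hilbert_on_def inner_product_on_def)

lemma part_pos_eq:
  assumes "p \<in> Hpos" "m \<in> Hneg"
  shows "part_pos (p + m) = p"
  unfolding part_pos_def
proof (rule the_equality)
  show "p \<in> Hpos \<and> p + m - p \<in> Hneg" using assms by simp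
  fix p' assume p': "p' \<in> Hpos \<and> p + m - p' \<in> Hneg"
  have "p' - p \<in> Hpos"
    by (rule subspace_diff[OF subspace_Hpos]) (use p' assms in simp_all)
  moreover have "m - (p + m - p') \<in> Hneg"
    by (rule subspace_diff[OF subspace_Hneg]) (use p' assms in simp_all)
  moreover have "m - (p + m - p') = p' - p" by simp
  ultimately have "p' - p \<in> Hpos \<inter> Hneg" by simp
  then show "p' = p" unfolding direct by simp
qed

lemma part_neg_eq:
  assumes "p \<in> Hpos" "m \<in> Hneg"
  shows "part_neg (p + m) = m"
  by (simp add: part_neg_def part_pos_eq[OF assms])

lemma parts:
  shows part_pos_mem: "part_pos x \<in> Hpos" and part_neg_mem: "part_neg x \<in> Hneg"
    and part_sum: "part_pos x + part_neg x = x"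
proof -
  obtain p m where "p \<in> Hpos" "m \<in> Hneg" "x = p + m"
    using decomposition by blast
  then show "part_pos x \<in> Hpos" "part_neg x \<in> Hneg" "part_pos x + part_neg x = x"
    by (simp_all add: part_pos_eq part_neg_eq)
qed

lemma parts_linear:
  "part_pos (x + y) = part_pos x + part_pos y"
  "part_neg (x + y) = part_neg x + part_neg y"
  "part_pos (scl a x) = scl a (part_pos x)"
  "part_neg (scl a x) = scl a (part_neg x)"
proof -
  have "x + y = (part_pos x + part_pos y) + (part_neg x + part_neg y)"
    using part_sum[of x] part_sum[of y] by (simp add: algebra_simps)
  moreover have "part_pos x + part_pos y \<in> Hpos" "part_neg x + part_neg y \<in> Hneg"
    by (intro subspace_add subspace_Hpos subspace_Hneg parts)+
  ultimately show "part_pos (x + y) = part_pos x + part_pos y"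
      "part_neg (x + y) = part_neg x + part_neg y"
    using part_pos_eq part_neg_eq by presburger+
  have "scl a x = scl a (part_pos x) + scl a (part_neg x)"
    using part_sum[of x] by (metis scale_right_distrib)
  moreover have "scl a (part_pos x) \<in> Hpos" "scl a (part_neg x) \<in> Hneg"
    by (intro subspace_scale subspace_Hpos subspace_Hneg parts)+
  ultimately show "part_pos (scl a x) = scl a (part_pos x)" "part_neg (scl a x) = scl a (part_neg x)"
    using part_pos_eq part_neg_eq by presburger+
qed

lemma inner_product_kinner: "inner_product_on scl kinner UNIV"
proof -
  have "kinner y x = cnj (kinner x y)" for x y
    unfolding kinner_def complex_cnj_diff
    by (intro arg_cong2[where f = "(-)"] bracket_commute)
  then have "hermitian_form scl kinner"
    unfolding hermitian_form_def
    by (intro conjI allI) (simp_all add: kinner_def parts_linear bracket_simps algebra_simps)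
  moreover have "0 < Re (kinner x x)" if "x \<noteq> 0" for x
  proof -
    have p: "0 < Re (bracket (part_pos x) (part_pos x))" if "part_pos x \<noteq> 0"
      using hilbert_pos that part_pos_mem unfolding hilbert_on_def inner_product_on_def by blast
    have m: "0 < - Re (bracket (part_neg x) (part_neg x))" if "part_neg x \<noteq> 0"
      using hilbert_neg that part_neg_mem unfolding hilbert_on_def inner_product_on_def by auto
    have z: "bracket 0 0 = 0" using bracket_simps(1)[of 0 0 0] by simp
    have "part_pos x \<noteq> 0 \<or> part_neg x \<noteq> 0" using part_sum[of x] that by auto
    then show ?thesis
      unfolding kinner_def using p m z
      by (cases "part_pos x = 0"; cases "part_neg x = 0") auto
  qed
  ultimately show ?thesis
    unfolding inner_product_on_def by (simp add: subspace_UNIV)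
qed

lemma Metric_space_kinner: "Metric_space UNIV (form_dist kinner)"
  by (rule inner_product_on_Metric_space[OF vector_space_axioms inner_product_kinner])

lemma bracket_eq_kinner: "bracket x y = kinner (fundamental_symmetry x) y"
proof -
  have neg: "- part_neg x \<in> Hneg" using subspace_neg[OF subspace_Hneg part_neg_mem] .
  have J: "part_pos (fundamental_symmetry x) = part_pos x"
      "part_neg (fundamental_symmetry x) = - part_neg x"
    using part_pos_eq[OF part_pos_mem neg] part_neg_eq[OF part_pos_mem neg]
    by (simp_all add: fundamental_symmetry_def)
  have o: "bracket (part_pos x) (part_neg y) = 0" "bracket (part_neg x) (part_pos y) = 0"
    using bracket_orthogonal[OF part_pos_mem part_neg_mem] bracket_commute[of "part_neg x" "part_pos y"]
    by simp_all
  have n: "bracket (- part_neg x) z = - bracket (part_neg x) z" for z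
    using bracket_simps(2)[of "-1" "part_neg x" z] by simp
  have "bracket x y = bracket (part_pos x + part_neg x) (part_pos y + part_neg y)"
    by (simp add: part_sum)
  then show ?thesis
    unfolding kinner_def J n by (simp add: bracket_simps o)
qed

end

locale separable_krein_space = krein_space +
  assumes separable: "separable_space ktopology"

end

theory Submission
  imports Defs
begin

text \<open>The closure of a uniformly \<open>J\<close>-positive subspace is again uniformly \<open>J\<close>-positive, so by
  maximality \<open>R(T\<^sub>+)\<close> is closed and equals \<open>M\<^sub>+\<close>, and on it \<open>[\<cdot>,\<cdot>]\<close> induces a norm equivalent to
  the ambient one. The upper bound is the Bessel inequality applied to \<open>J x\<close>. For the lower bound,
  Cauchy--Schwarz gives \<open>\<bar>[y, T c]\<bar> \<le> \<parallel>c\<parallel> s(y)\<^bsup>1/2\<^esup>\<close>, where \<open>s(y)\<close> is the sum of the \<open>\<bar>[y, f\<^sub>i]\<bar>\<^sup>2\<close>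
  over \<open>i \<in> I\<^sub>+\<close>; as \<open>T\<^sub>+\<close> maps onto \<open>M\<^sub>+\<close>, the vectors with \<open>s(y) \<le> 1\<close> form a weakly bounded
  subset of \<open>M\<^sub>+\<close>, which is bounded by Banach--Steinhaus. The negative part is the positive part of
  the Krein space with form \<open>-[\<cdot>,\<cdot>]\<close>, which has the same Hilbert space inner product.\<close>

section \<open>Inner product spaces carried by a subspace\<close>

text \<open>The form is Hermitian on the whole type and only its positivity is confined to
  \<open>S\<close>. Hence the algebraic rules below need no membership, and the same locale serves
  \<open>kinner\<close> on the full space, \<open>bracket\<close> on \<open>Hpos\<close>, its
  negative on \<open>Hneg\<close>, and later \<open>bracket\<close> on the closed spans.\<close>

locale inner_product_subspace = vector_space scl
  for scl :: "complex \<Rightarrow> 'h::ab_group_add \<Rightarrow> 'h" +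
  fixes q :: "'h \<Rightarrow> 'h \<Rightarrow> complex" and S :: "'h set"
  assumes inner_product: "inner_product_on scl q S"
begin

lemma subspace_S: "subspace S"
  using inner_product by (simp add: inner_product_on_def)

lemma form_add_left: "q (x + y) z = q x z + q y z"
  and form_scale_left: "q (scl a x) y = a * q x y"
  and form_commute: "q y x = cnj (q x y)"
  using inner_product unfolding inner_product_on_def hermitian_form_def by blast+

lemma form_add_right: "q x (y + z) = q x y + q x z"
  by (subst (1 2 3) form_commute) (simp add: form_add_left)

lemma form_scale_right: "q x (scl a y) = cnj a * q x y"
  by (subst (1 2) form_commute) (simp add: form_scale_left)

lemma form_minus_left: "q (- x) y = - q x y"
  using form_scale_left[of "-1" x y] by simp

lemma form_minus_right: "q x (- y) = - q x y"
  using form_scale_right[of x "-1" y] by simp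

lemma form_diff_left: "q (x - y) z = q x z - q y z"
  using form_add_left[of x "- y" z] by (simp add: form_minus_left)

lemma form_diff_right: "q x (y - z) = q x y - q x z"
  using form_add_right[of x y "- z"] by (simp add: form_minus_right)

lemma form_zero [simp]: "q 0 x = 0" "q x 0 = 0"
  using form_scale_left[of 0 0 x] form_scale_right[of x 0 0] by simp_all

lemma form_sum_right: "q y (sum g F) = (\<Sum>i\<in>F. q y (g i))"
  by (induction F rule: infinite_finite_induct) (simp_all add: form_add_right)

lemma form_self: "q x x = of_real (Re (q x x))"
  using form_commute[of x x] by (simp add: complex_eq_iff)

lemma form_pos: "\<lbrakk>x \<in> S; x \<noteq> 0\<rbrakk> \<Longrightarrow> 0 < Re (q x x)"
  using inner_product by (simp add: inner_product_on_def)

lemma form_nonneg: "x \<in> S \<Longrightarrow> 0 \<le> Re (q x x)"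
  using form_pos[of x] by (cases "x = 0") auto

lemma form_norm_nonneg [simp]: "0 \<le> form_norm q x"
  by (simp add: form_norm_def)

lemma form_norm_zero [simp]: "form_norm q 0 = 0"
  by (simp add: form_norm_def)

lemma form_norm_eq_0: "x \<in> S \<Longrightarrow> form_norm q x = 0 \<longleftrightarrow> x = 0"
  using form_pos[of x] by (cases "x = 0") (auto simp: form_norm_def)

lemma form_norm_sq: "x \<in> S \<Longrightarrow> (form_norm q x)\<^sup>2 = Re (q x x)"
  using form_nonneg[of x] by (simp add: form_norm_def)

lemma form_norm_scale: "form_norm q (scl a x) = cmod a * form_norm q x"
proof -
  have "q (scl a x) (scl a x) = of_real ((cmod a)\<^sup>2 * Re (q x x))"
    using form_self[of x] complex_norm_square[of a]
    by (simp add: form_scale_left form_scale_right mult.commute[of "cnj a"] mult.assoc[symmetric])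
  then show ?thesis
    by (simp add: form_norm_def abs_mult real_sqrt_mult)
qed

lemma form_norm_minus: "form_norm q (- x) = form_norm q x"
  using form_norm_scale[of "-1" x] by simp

lemma form_norm_diff_commute: "form_norm q (x - y) = form_norm q (y - x)"
  using form_norm_minus[of "x - y"] by simp

lemma form_Cauchy_Schwarz:
  assumes "x \<in> S" "y \<in> S"
  shows "cmod (q x y) \<le> form_norm q x * form_norm q y"
proof (cases "y = 0")
  case False
  define c where "c = Re (q y y)"
  have c: "c > 0" using form_pos assms False by (simp add: c_def)
  have qy: "q y y = of_real c" unfolding c_def by (rule form_self)
  \<comment> \<open>\<open>scl t y\<close> is the orthogonal projection of \<open>x\<close> onto the
    line through \<open>y\<close>. The squared length of the remainder is \<open>q x x\<close> minus
    \<open>(cmod (q x y))\<^sup>2 / c\<close>, and its nonnegativity is the claim.\<close>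
  define t where "t = q x y / of_real c"
  have "x - scl t y \<in> S"
    using assms subspace_diff subspace_scale subspace_S by blast
  then have "0 \<le> Re (q (x - scl t y) (x - scl t y))" by (rule form_nonneg)
  also have "q (x - scl t y) (x - scl t y) = q x x - of_real ((cmod (q x y))\<^sup>2 / c)"
    using c form_commute[of y x]
    by (simp add: form_diff_left form_diff_right form_scale_left form_scale_right qy t_def
        complex_norm_square field_simps del: of_real_power)
  finally have "(cmod (q x y))\<^sup>2 \<le> Re (q x x) * c"
    using c by (simp add: field_simps)
  then have "cmod (q x y) \<le> sqrt (Re (q x x) * c)"
    by (rule real_le_rsqrt)
  then show ?thesis
    using assms form_nonneg by (simp add: form_norm_def real_sqrt_mult c_def)
qed simp

lemma Metric_space_form_dist: "Metric_space S (form_dist q)"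
  by (rule inner_product_on_Metric_space[OF vector_space_axioms inner_product])

lemma form_norm_triangle:
  assumes "x \<in> S" "y \<in> S"
  shows "form_norm q (x + y) \<le> form_norm q x + form_norm q y"
proof -
  have "form_dist q x (- y) \<le> form_dist q x 0 + form_dist q 0 (- y)"
    by (rule Metric_space.triangle[OF Metric_space_form_dist])
      (use assms subspace_S subspace_neg subspace_0 in auto)
  then show ?thesis by (simp add: form_dist_def)
qed

lemma form_norm_triangle_diff:
  assumes "x \<in> S" "y \<in> S"
  shows "form_norm q x \<le> form_norm q y + form_norm q (x - y)"
  using form_norm_triangle[of y "x - y"] assms subspace_diff[OF subspace_S] by simp

text \<open>This is the uniform boundedness principle for the functionals \<open>q _ y\<close> with
  \<open>y\<close> in \<open>Y\<close>. By Baire, one common bound holds on a whole ball; moving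
  from its centre in the direction of \<open>y\<close> then bounds \<open>y\<close> itself.\<close>

lemma weakly_bounded_imp_bounded:
  assumes complete: "Metric_space.mcomplete S (form_dist q)"
    and "Y \<subseteq> S" and bounded: "\<And>z. z \<in> S \<Longrightarrow> \<exists>k. \<forall>y\<in>Y. cmod (q z y) \<le> k"
  shows "\<exists>K. \<forall>y\<in>Y. form_norm q y \<le> K"
proof -
  interpret m: Metric_space S "form_dist q" by (rule Metric_space_form_dist)
  \<comment> \<open>The points where all functionals are bounded by the same \<open>n\<close>.
    Pointwise boundedness says exactly that these sets exhaust \<open>S\<close>.\<close>
  define E where "E n = {z \<in> S. \<forall>y\<in>Y. cmod (q z y) \<le> real n}" for n :: nat
  have cover: "\<Union>(range E) = S"
  proof
    show "S \<subseteq> \<Union>(range E)"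
    proof
      fix z assume z: "z \<in> S"
      then obtain k where k: "\<forall>y\<in>Y. cmod (q z y) \<le> k" using bounded by blast
      then have "z \<in> E (nat \<lceil>k\<rceil>)"
        using z by (auto simp: E_def) (meson order_trans real_nat_ceiling_ge)
      then show "z \<in> \<Union>(range E)" by blast
    qed
  qed (auto simp: E_def)
  have closed: "closedin m.mtopology (E n)" for n
  proof (subst closure_of_subset_eq[symmetric], intro conjI subsetI)
    fix z assume "z \<in> m.mtopology closure_of E n"
    then have z: "z \<in> S" and near: "\<And>r. r > 0 \<Longrightarrow> \<exists>w\<in>E n. form_dist q z w < r"
      by (auto simp: m.metric_closure_of)
    have "cmod (q z y) \<le> real n" if y: "y \<in> Y" for y
    proof (rule field_le_epsilon)
      fix e :: real assume e: "e > 0"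
      \<comment> \<open>A point of \<open>E n\<close> at distance below \<open>r\<close> changes the
        functional at \<open>y\<close> by at most \<open>e\<close>. The added 1 keeps the
        denominator positive when \<open>y\<close> is 0.\<close>
      define r where "r = e / (form_norm q y + 1)"
      have pos: "form_norm q y + 1 > 0" using form_norm_nonneg[of y] by linarith
      then have "r > 0" using e by (simp add: r_def)
      then obtain w where w: "w \<in> E n" "form_norm q (z - w) < r"
        using near by (auto simp: form_dist_def)
      have wS: "w \<in> S" using w by (simp add: E_def)
      have "cmod (q z y) = cmod (q w y + q (z - w) y)" by (simp add: form_diff_left)
      also have "\<dots> \<le> cmod (q w y) + cmod (q (z - w) y)" by (rule norm_triangle_ineq)
      also have "cmod (q w y) \<le> n" using w y by (simp add: E_def)
      also have "cmod (q (z - w) y) \<le> form_norm q (z - w) * form_norm q y"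
        using form_Cauchy_Schwarz subspace_diff[OF subspace_S z wS] y \<open>Y \<subseteq> S\<close> by blast
      also have "\<dots> \<le> r * (form_norm q y + 1)"
        using w \<open>r > 0\<close> by (intro mult_mono) auto
      also have "\<dots> = e" using pos by (simp add: r_def)
      finally show "cmod (q z y) \<le> real n + e" by simp
    qed
    then show "z \<in> E n" using z by (simp add: E_def)
  qed (simp add: E_def)
  \<comment> \<open>If every closed set \<open>E n\<close> had empty interior, Baire's theorem would
    give their union \<open>S\<close> empty interior. But \<open>S\<close> is open in itself and
    contains 0.\<close>
  have "\<exists>n. m.mtopology interior_of E n \<noteq> {}"
  proof (rule ccontr)
    assume "\<nexists>n. m.mtopology interior_of E n \<noteq> {}"
    then have "m.mtopology interior_of \<Union>(range E) = {}"
      using closed by (intro m.metric_Baire_category_alt complete) auto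
    then have "S = {}"
      unfolding cover using interior_of_topspace[of m.mtopology] by simp
    then show False using subspace_0[OF subspace_S] by simp
  qed
  then obtain n z r where z: "z \<in> S" and r: "r > 0" and sub: "m.mcball z r \<subseteq> E n"
    by (auto simp: m.metric_interior_of_alt)
  have "form_norm q y \<le> 2 * n / r" if y: "y \<in> Y" for y
  proof (cases "y = 0")
    case False
    define s where "s = form_norm q y"
    have yS: "y \<in> S" using y \<open>Y \<subseteq> S\<close> by blast
    then have s: "s > 0"
      using form_norm_eq_0 False form_norm_nonneg[of y] by (auto simp: s_def less_le)
    \<comment> \<open>\<open>y\<close> rescaled to length \<open>r\<close>, so that
      \<open>z + u\<close> is still in the closed ball. Since \<open>q u y = r * s\<close> is the
      difference of the values at \<open>z + u\<close> and \<open>z\<close>, both of modulus at most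
      \<open>n\<close>, it follows that \<open>s\<close> is at most
      \<open>2 * n / r\<close>.\<close>
    define u where "u = scl (of_real (r / s)) y"
    have u: "u \<in> S" "form_norm q u = r"
      using yS s r subspace_scale[OF subspace_S] by (auto simp: u_def form_norm_scale norm_divide s_def[symmetric])
    have "z + u \<in> m.mcball z r"
      using z u subspace_add[OF subspace_S] by (simp add: form_dist_def form_norm_minus)
    moreover have "z \<in> m.mcball z r" using z r by simp
    ultimately have b: "cmod (q (z + u) y) \<le> n" "cmod (q z y) \<le> n"
      using sub y by (auto simp: E_def)
    have "q y y = of_real (s * s)"
      by (subst form_self) (simp add: s_def form_norm_sq[OF yS] flip: power2_eq_square of_real_mult)
    then have "q u y = of_real (r * s)"
      using s by (simp add: u_def form_scale_left)
    then have "r * s = cmod (q (z + u) y - q z y)"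
      using r s by (simp add: form_add_left norm_mult)
    also have "\<dots> \<le> 2 * n"
      using norm_triangle_ineq4[of "q (z + u) y" "q z y"] b by simp
    finally show ?thesis using r by (simp add: s_def field_simps)
  qed (use r in simp)
  then show ?thesis by blast
qed

end

section \<open>Truncation of square summable families\<close>

lemma l2_mono: "K \<subseteq> I \<Longrightarrow> c \<in> l2 K \<Longrightarrow> c \<in> l2 I"
  unfolding l2_def
  using summable_on_cong_neutral[of I K "\<lambda>i. (cmod (c i))\<^sup>2" "\<lambda>i. (cmod (c i))\<^sup>2"] by auto

lemma l2_unit_mem: "i \<in> I \<Longrightarrow> l2_unit i \<in> l2 I"
  by (rule l2_mono[of "{i}"]) (auto simp: l2_def l2_unit_def)

text \<open>Since \<open>c\<close> vanishes off \<open>I\<close>, projecting to \<open>K\<close>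
  leaves support in \<open>K \<inter> I\<close>. The set \<open>K\<close> is arbitrary so that
  complements \<open>- F\<close> of finite sets are covered as well.\<close>

lemma l2_proj_mem: "c \<in> l2 I \<Longrightarrow> l2_proj K c \<in> l2 (K \<inter> I)"
proof -
  assume c: "c \<in> l2 I"
  have "l2_proj K c = l2_proj (K \<inter> I) c"
    using c by (auto simp: l2_proj_def l2_def)
  then show ?thesis using l2_proj_orthogonal_projection(1)[OF _ c, of "K \<inter> I"] by simp
qed

lemma l2_proj_insert:
  "i \<notin> F \<Longrightarrow> l2_proj (insert i F) c = (\<lambda>j. l2_proj F c j + c i * l2_unit i j)"
  by (auto simp: l2_proj_def l2_unit_def)

lemma l2_norm_nonneg [simp]: "0 \<le> l2_norm I c"
  by (simp add: l2_norm_def infsum_nonneg)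

text \<open>As \<open>c\<close> vanishes off \<open>K\<close>, deleting the coordinates in
  \<open>F\<close> leaves the sum over \<open>K - F\<close>. This is the tail of a convergent sum,
  which a suitable finite \<open>F\<close> makes as small as desired.\<close>

lemma l2_norm_cofinite_proj:
  assumes "K \<subseteq> I" "c \<in> l2 K" "finite F" "F \<subseteq> K"
  shows "(l2_norm I (l2_proj (- F) c))\<^sup>2
    = (\<Sum>\<^sub>\<infinity>i\<in>K. (cmod (c i))\<^sup>2) - (\<Sum>i\<in>F. (cmod (c i))\<^sup>2)"
proof -
  have "(l2_norm I (l2_proj (- F) c))\<^sup>2 = (\<Sum>\<^sub>\<infinity>i\<in>I. (cmod (l2_proj (- F) c i))\<^sup>2)"
    by (simp add: l2_norm_def infsum_nonneg)
  also have "\<dots> = (\<Sum>\<^sub>\<infinity>i\<in>K - F. (cmod (c i))\<^sup>2)"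
    using assms by (intro infsum_cong_neutral) (auto simp: l2_proj_def l2_def)
  also have "\<dots> = (\<Sum>\<^sub>\<infinity>i\<in>K. (cmod (c i))\<^sup>2) - (\<Sum>\<^sub>\<infinity>i\<in>F. (cmod (c i))\<^sup>2)"
    using assms by (intro infsum_Diff) (auto simp: l2_def)
  finally show ?thesis using assms by simp
qed

section \<open>Completeness of the ambient Hilbert space and continuity of the bracket\<close>

context krein_space
begin

interpretation K: inner_product_subspace scl kinner UNIV
  by unfold_locales (rule inner_product_kinner)

interpretation P: inner_product_subspace scl bracket Hpos
  using hilbert_pos by unfold_locales (simp add: hilbert_on_def)

interpretation N: inner_product_subspace scl "\<lambda>x y. - bracket x y" Hneg
  using hilbert_neg by unfold_locales (simp add: hilbert_on_def)

lemma parts_diff: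
  "part_pos (x - y) = part_pos x - part_pos y"
  "part_neg (x - y) = part_neg x - part_neg y"
  using parts_linear(1,2)[of "x - y" y] by simp_all

lemma knorm_sq_parts:
  "(knorm x)\<^sup>2 = (form_norm bracket (part_pos x))\<^sup>2
    + (form_norm (\<lambda>x y. - bracket x y) (part_neg x))\<^sup>2"
  using K.form_norm_sq[of x] P.form_norm_sq[OF part_pos_mem] N.form_norm_sq[OF part_neg_mem]
  by (simp add: kinner_def)

lemma form_norm_parts_le:
  "form_norm bracket (part_pos x) \<le> knorm x"
  "form_norm (\<lambda>x y. - bracket x y) (part_neg x) \<le> knorm x"
  by (rule power2_le_imp_le; simp add: knorm_sq_parts)+

lemma knorm_le_parts:
  "knorm x \<le> form_norm bracket (part_pos x) + form_norm (\<lambda>x y. - bracket x y) (part_neg x)"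
  by (rule power2_le_imp_le) (simp_all add: knorm_sq_parts power2_sum)

text \<open>Each component is dominated by \<open>knorm\<close>, so the components of a Cauchy
  sequence are Cauchy in the complete spaces \<open>Hpos\<close> and \<open>Hneg\<close>. The sum of
  the two limits is the limit, because \<open>knorm\<close> is at most the sum of the component
  norms.\<close>

lemma mcomplete_kinner: "Metric_space.mcomplete UNIV (form_dist kinner)"
proof -
  interpret m: Metric_space UNIV "form_dist kinner" by (rule Metric_space_kinner)
  interpret p: Metric_space Hpos "form_dist bracket" by (rule P.Metric_space_form_dist)
  interpret n: Metric_space Hneg "form_dist (\<lambda>x y. - bracket x y)" by (rule N.Metric_space_form_dist)
  show ?thesis
    unfolding m.mcomplete_def
  proof (intro allI impI)
    fix \<sigma> assume "m.MCauchy \<sigma>"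
    then have \<sigma>: "\<exists>N. \<forall>i j. N \<le> i \<longrightarrow> N \<le> j \<longrightarrow> knorm (\<sigma> i - \<sigma> j) < e" if "e > 0" for e
      using that by (simp add: m.MCauchy_def form_dist_def)
    have "p.MCauchy (\<lambda>k. part_pos (\<sigma> k))"
      unfolding p.MCauchy_def form_dist_def parts_diff[symmetric]
      using \<sigma> form_norm_parts_le(1) part_pos_mem by (auto intro: le_less_trans) (meson le_less_trans)
    then obtain a where a: "limitin p.mtopology (\<lambda>k. part_pos (\<sigma> k)) a sequentially"
      using hilbert_pos by (auto simp: hilbert_on_def p.mcomplete_def)
    have "n.MCauchy (\<lambda>k. part_neg (\<sigma> k))"
      unfolding n.MCauchy_def form_dist_def parts_diff[symmetric]
      using \<sigma> form_norm_parts_le(2) part_neg_mem by (auto intro: le_less_trans) (meson le_less_trans)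
    then obtain b where b: "limitin n.mtopology (\<lambda>k. part_neg (\<sigma> k)) b sequentially"
      using hilbert_neg by (auto simp: hilbert_on_def n.mcomplete_def)
    have ab: "a \<in> Hpos" "b \<in> Hneg"
      using a b by (simp_all add: p.limitin_metric n.limitin_metric)
    have "limitin m.mtopology \<sigma> (a + b) sequentially"
      unfolding m.limitin_metric
    proof (intro conjI allI impI)
      fix e :: real assume "e > 0"
      then have "\<forall>\<^sub>F k in sequentially. form_norm bracket (part_pos (\<sigma> k) - a) < e / 2"
        "\<forall>\<^sub>F k in sequentially. form_norm (\<lambda>x y. - bracket x y) (part_neg (\<sigma> k) - b) < e / 2"
        using a b half_gt_zero[OF \<open>e > 0\<close>]
        unfolding p.limitin_metric n.limitin_metric form_dist_def
        by (blast intro: eventually_mono)+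
      then show "\<forall>\<^sub>F k in sequentially. \<sigma> k \<in> UNIV \<and> form_dist kinner (\<sigma> k) (a + b) < e"
      proof eventually_elim
        case (elim k)
        then show ?case
          using knorm_le_parts[of "\<sigma> k - (a + b)"]
          by (simp add: form_dist_def parts_diff part_pos_eq[OF ab] part_neg_eq[OF ab])
      qed
    qed simp
    then show "\<exists>x. limitin m.mtopology \<sigma> x sequentially" by blast
  qed
qed

text \<open>The symmetry only changes the sign of the negative part, which does not affect the
  Pythagorean formula for \<open>knorm\<close>.\<close>

lemma knorm_fundamental_symmetry: "knorm (fundamental_symmetry x) = knorm x"
proof -
  have J: "fundamental_symmetry x = part_pos x + - part_neg x"
    by (simp add: fundamental_symmetry_def)
  have neg: "- part_neg x \<in> Hneg" by (rule subspace_neg[OF subspace_Hneg part_neg_mem])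
  have "(knorm (fundamental_symmetry x))\<^sup>2 = (knorm x)\<^sup>2"
    unfolding knorm_sq_parts J part_pos_eq[OF part_pos_mem neg] part_neg_eq[OF part_pos_mem neg]
    by (simp add: N.form_norm_minus)
  then show ?thesis by (simp add: power2_eq_iff_nonneg)
qed

lemma bracket_le_knorm: "cmod (bracket x y) \<le> knorm x * knorm y"
  using K.form_Cauchy_Schwarz[of "fundamental_symmetry x" y]
  by (simp add: bracket_eq_kinner knorm_fundamental_symmetry)

lemma in_ktopology_closure_of:
  "x \<in> ktopology closure_of S \<longleftrightarrow> (\<forall>e>0. \<exists>y\<in>S. knorm (y - x) < e)"
proof -
  interpret m: Metric_space UNIV "form_dist kinner" by (rule Metric_space_kinner)
  show ?thesis
    by (simp add: ktopology_def m.metric_closure_of form_dist_def K.form_norm_diff_commute[of x])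
qed

lemma ktopology_closure_ofE:
  assumes "x \<in> ktopology closure_of S"
  obtains \<sigma> :: "nat \<Rightarrow> 'h" where "\<And>n. \<sigma> n \<in> S" "(\<lambda>n. knorm (\<sigma> n - x)) \<longlonglongrightarrow> 0"
proof -
  have "\<exists>y\<in>S. knorm (y - x) < inverse (real (Suc n))" for n
    using assms unfolding in_ktopology_closure_of by simp
  then obtain \<sigma> where \<sigma>: "\<And>n. \<sigma> n \<in> S" "\<And>n. knorm (\<sigma> n - x) < inverse (real (Suc n))"
    by metis
  have "(\<lambda>n. knorm (\<sigma> n - x)) \<longlonglongrightarrow> 0"
    by (rule tendsto_sandwich[OF _ _ tendsto_const LIMSEQ_inverse_real_of_nat])
      (use \<sigma>(2) in \<open>auto intro!: always_eventually less_imp_le\<close>)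
  with \<sigma>(1) show ?thesis by (rule that)
qed

lemma subset_ktopology_closure_of: "S \<subseteq> ktopology closure_of S"
proof
  fix x assume "x \<in> S"
  then show "x \<in> ktopology closure_of S"
    unfolding in_ktopology_closure_of by (intro allI impI bexI[of _ x]) simp_all
qed

lemma subspace_ktopology_closure_of:
  assumes S: "subspace S"
  shows "subspace (ktopology closure_of S)"
proof (rule subspaceI)
  show "0 \<in> ktopology closure_of S"
    using subset_ktopology_closure_of subspace_0[OF S] by blast
next
  fix x y assume "x \<in> ktopology closure_of S" "y \<in> ktopology closure_of S"
  then have xy: "\<exists>x'\<in>S. knorm (x' - x) < e" "\<exists>y'\<in>S. knorm (y' - y) < e" if "e > 0" for e
    using that by (simp_all add: in_ktopology_closure_of)
  show "x + y \<in> ktopology closure_of S"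
    unfolding in_ktopology_closure_of
  proof (intro allI impI)
    fix e :: real assume "e > 0"
    then obtain x' y' where "x' \<in> S" "y' \<in> S" "knorm (x' - x) < e/2" "knorm (y' - y) < e/2"
      using xy[of "e/2"] by auto
    then show "\<exists>z\<in>S. knorm (z - (x + y)) < e"
      using K.form_norm_triangle[of "x' - x" "y' - y"] subspace_add[OF S]
      by (intro bexI[of _ "x' + y'"]) (auto simp: algebra_simps)
  qed
next
  fix a x assume x: "x \<in> ktopology closure_of S"
  show "scl a x \<in> ktopology closure_of S"
    unfolding in_ktopology_closure_of
  proof (intro allI impI)
    fix e :: real assume e: "e > 0"
    \<comment> \<open>Adding 1 to \<open>cmod a\<close> also covers the scalar 0.\<close>
    define r where "r = e / (cmod a + 1)"
    have a: "cmod a + 1 > 0" using norm_ge_zero[of a] by linarith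
    then have "r > 0" using e by (simp add: r_def)
    then obtain y where y: "y \<in> S" "knorm (y - x) < r"
      using x unfolding in_ktopology_closure_of by blast
    have "knorm (scl a y - scl a x) = cmod a * knorm (y - x)"
      by (simp add: scale_right_diff_distrib[symmetric] K.form_norm_scale)
    also have "\<dots> \<le> cmod a * r" using y by (intro mult_left_mono) auto
    also have "\<dots> < (cmod a + 1) * r" using \<open>r > 0\<close> by simp
    also have "\<dots> = e" using a by (simp add: r_def)
    finally show "\<exists>z\<in>S. knorm (z - scl a x) < e"
      using y subspace_scale[OF S] by blast
  qed
qed

lemma tendsto_knorm:
  assumes "(\<lambda>n. knorm (\<sigma> n - x)) \<longlonglongrightarrow> 0"
  shows "(\<lambda>n. knorm (\<sigma> n)) \<longlonglongrightarrow> knorm x"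
proof -
  have "\<bar>knorm (\<sigma> n) - knorm x\<bar> \<le> knorm (\<sigma> n - x)" for n
    using K.form_norm_triangle_diff[of "\<sigma> n" x] K.form_norm_triangle_diff[of x "\<sigma> n"]
      K.form_norm_diff_commute[of x "\<sigma> n"] by simp
  then have "(\<lambda>n. knorm (\<sigma> n) - knorm x) \<longlonglongrightarrow> 0"
    by (intro Lim_null_comparison[OF always_eventually assms]) simp
  then show ?thesis by (simp add: LIM_zero_iff)
qed

lemma tendsto_bracket_self:
  assumes lim: "(\<lambda>n. knorm (\<sigma> n - x)) \<longlonglongrightarrow> 0"
  shows "(\<lambda>n. bracket (\<sigma> n) (\<sigma> n)) \<longlonglongrightarrow> bracket x x"
proof -
  have "cmod (bracket (\<sigma> n) (\<sigma> n) - bracket x x) \<le> knorm (\<sigma> n - x) * (knorm (\<sigma> n) + knorm x)" for n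
  proof -
    \<comment> \<open>Changing one argument at a time leaves two terms that each contain
      \<open>\<sigma> n - x\<close>, to which the bound \<open>bracket_le_knorm\<close>
      applies.\<close>
    have "bracket (\<sigma> n) (\<sigma> n) - bracket x x = bracket (\<sigma> n - x) (\<sigma> n) + bracket x (\<sigma> n - x)"
      by (simp add: P.form_diff_left P.form_diff_right)
    also have "cmod \<dots> \<le> knorm (\<sigma> n - x) * knorm (\<sigma> n) + knorm x * knorm (\<sigma> n - x)"
      by (intro order_trans[OF norm_triangle_ineq] add_mono bracket_le_knorm)
    finally show ?thesis by (simp add: algebra_simps)
  qed
  moreover have "(\<lambda>n. knorm (\<sigma> n - x) * (knorm (\<sigma> n) + knorm x)) \<longlonglongrightarrow> 0 * (knorm x + knorm x)"
    by (intro tendsto_intros lim tendsto_knorm)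
  ultimately have "(\<lambda>n. bracket (\<sigma> n) (\<sigma> n) - bracket x x) \<longlonglongrightarrow> 0"
    using Lim_null_comparison[OF always_eventually] by force
  then show ?thesis by (simp add: LIM_zero_iff)
qed

section \<open>Closed uniformly J-positive subspaces\<close>

text \<open>Both sides of the defining inequality are continuous in \<open>knorm\<close>, so it
  passes to limits with the same \<alpha>.\<close>

lemma uniformly_J_positive_closure_of:
  assumes "uniformly_J_positive S"
  shows "uniformly_J_positive (ktopology closure_of S)"
proof -
  obtain \<alpha> where sub: "subspace S" and \<alpha>: "\<alpha> > 0"
    and pos: "\<And>x. x \<in> S \<Longrightarrow> \<alpha> * (knorm x)\<^sup>2 \<le> Re (bracket x x)"
    using assms by (auto simp: uniformly_J_positive_def)
  have "\<alpha> * (knorm x)\<^sup>2 \<le> Re (bracket x x)" if x: "x \<in> ktopology closure_of S" for x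
  proof -
    obtain \<sigma> where \<sigma>: "\<And>n. \<sigma> n \<in> S" and lim: "(\<lambda>n. knorm (\<sigma> n - x)) \<longlonglongrightarrow> 0"
      using ktopology_closure_ofE[OF x] by blast
    show ?thesis
      by (rule LIMSEQ_le[OF tendsto_mult[OF tendsto_const tendsto_power[OF tendsto_knorm[OF lim]]]
            tendsto_Re[OF tendsto_bracket_self[OF lim]]])
        (use pos \<sigma> in blast)
  qed
  then show ?thesis
    using \<alpha> subspace_ktopology_closure_of[OF sub] by (auto simp: uniformly_J_positive_def)
qed

lemma maximal_uniformly_J_positive_closed:
  "maximal_uniformly_J_positive S \<Longrightarrow> ktopology closure_of S = S"
  using uniformly_J_positive_closure_of subset_ktopology_closure_of
  by (auto simp: maximal_uniformly_J_positive_def)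

text \<open>On \<open>S\<close> the norm of \<open>bracket\<close> lies between
  \<open>sqrt \<alpha> * knorm\<close> and \<open>knorm\<close>. A Cauchy sequence for it therefore
  converges in the complete ambient space, closedness keeps the limit in \<open>S\<close>, and the
  upper bound gives convergence in the norm of \<open>bracket\<close>.\<close>

lemma hilbert_on_uniformly_J_positive:
  assumes "uniformly_J_positive S" and closed: "ktopology closure_of S = S"
  shows "hilbert_on scl bracket S"
proof -
  obtain \<alpha> where sub: "subspace S" and \<alpha>: "\<alpha> > 0"
    and pos: "\<And>x. x \<in> S \<Longrightarrow> \<alpha> * (knorm x)\<^sup>2 \<le> Re (bracket x x)"
    using assms(1) by (auto simp: uniformly_J_positive_def)
  have "0 < Re (bracket x x)" if "x \<in> S" "x \<noteq> 0" for x
  proof -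
    have "knorm x \<noteq> 0" using K.form_norm_eq_0[of x] that by simp
    then have "0 < \<alpha> * (knorm x)\<^sup>2" using \<alpha> by simp
    then show ?thesis using pos[OF that(1)] by linarith
  qed
  then have ip: "inner_product_on scl bracket S"
    using hermitian sub by (simp add: inner_product_on_def)
  interpret S: inner_product_subspace scl bracket S by unfold_locales (rule ip)
  interpret m: Metric_space UNIV "form_dist kinner" by (rule Metric_space_kinner)
  interpret s: Metric_space S "form_dist bracket" by (rule S.Metric_space_form_dist)
  have lower: "sqrt \<alpha> * knorm x \<le> form_norm bracket x" if "x \<in> S" for x
    by (rule power2_le_imp_le)
      (use pos[OF that] S.form_norm_sq[OF that] \<alpha> in \<open>simp_all add: power_mult_distrib\<close>)
  have upper: "form_norm bracket x \<le> knorm x" if "x \<in> S" for x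
    using order_trans[OF abs_Re_le_cmod bracket_le_knorm[of x x]]
    by (simp add: form_norm_def[of bracket] power2_eq_square real_le_lsqrt)
  have "s.mcomplete"
    unfolding s.mcomplete_def
  proof (intro allI impI)
    fix \<sigma> assume \<sigma>: "s.MCauchy \<sigma>"
    then have mem: "\<And>n. \<sigma> n \<in> S" by (auto simp: s.MCauchy_def)
    have "m.MCauchy \<sigma>"
      unfolding m.MCauchy_def
    proof (intro conjI allI impI)
      fix e :: real assume "e > 0"
      \<comment> \<open>The factor \<open>sqrt \<alpha>\<close> cancels against the one in
        \<open>lower\<close>, which leaves \<open>knorm\<close> below \<open>e\<close>.\<close>
      then obtain N where N: "\<And>i j. N \<le> i \<Longrightarrow> N \<le> j \<Longrightarrow> form_norm bracket (\<sigma> i - \<sigma> j) < sqrt \<alpha> * e"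
        using \<sigma> mult_pos_pos[OF real_sqrt_gt_zero[OF \<alpha>]]
        unfolding s.MCauchy_def form_dist_def by blast
      have "form_dist kinner (\<sigma> i) (\<sigma> j) < e" if "N \<le> i" "N \<le> j" for i j
      proof -
        have "sqrt \<alpha> * knorm (\<sigma> i - \<sigma> j) < sqrt \<alpha> * e"
          using lower[OF subspace_diff[OF sub mem mem]] N[OF that] by (rule le_less_trans)
        then show ?thesis using \<alpha> by (simp add: form_dist_def)
      qed
      then show "\<exists>N. \<forall>i j. N \<le> i \<longrightarrow> N \<le> j \<longrightarrow> form_dist kinner (\<sigma> i) (\<sigma> j) < e" by blast
    qed simp
    then obtain x where x: "limitin m.mtopology \<sigma> x sequentially"
      using mcomplete_kinner by (auto simp: m.mcomplete_def)
    have near: "\<forall>\<^sub>F n in sequentially. knorm (\<sigma> n - x) < e" if "e > 0" for e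
      using x that by (simp add: m.limitin_metric form_dist_def)
    have "x \<in> ktopology closure_of S"
      unfolding in_ktopology_closure_of
    proof (intro allI impI)
      fix e :: real assume "e > 0"
      then obtain n where "knorm (\<sigma> n - x) < e"
        using eventually_happens'[OF sequentially_bot near] by blast
      then show "\<exists>y\<in>S. knorm (y - x) < e" using mem by blast
    qed
    then have xS: "x \<in> S" using closed by simp
    have "limitin s.mtopology \<sigma> x sequentially"
      unfolding s.limitin_metric
    proof (intro conjI allI impI xS)
      fix e :: real assume "e > 0"
      show "\<forall>\<^sub>F n in sequentially. \<sigma> n \<in> S \<and> form_dist bracket (\<sigma> n) x < e"
        using near[OF \<open>e > 0\<close>]
      proof eventually_elim
        case (elim n)
        then show ?case
          using mem le_less_trans[OF upper[OF subspace_diff[OF sub mem xS]]] by (simp add: form_dist_def)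
      qed
    qed
    then show "\<exists>x. limitin s.mtopology \<sigma> x sequentially" by blast
  qed
  then show ?thesis using ip by (simp add: hilbert_on_def)
qed

section \<open>The synthesis operator and its range\<close>

lemma synthesis_operatorD:
  assumes "synthesis_operator I f T"
  shows "\<lbrakk>c \<in> l2 I; d \<in> l2 I\<rbrakk> \<Longrightarrow> T (\<lambda>i. c i + d i) = T c + T d"
    and "c \<in> l2 I \<Longrightarrow> T (\<lambda>i. a * c i) = scl a (T c)"
    and "\<exists>C. \<forall>c\<in>l2 I. knorm (T c) \<le> C * l2_norm I c"
    and "i \<in> I \<Longrightarrow> T (l2_unit i) = f i"
  using assms by (simp_all add: synthesis_operator_def)

lemma synthesis_operator_finite:
  assumes T: "synthesis_operator I f T" and "c \<in> l2 I" and "finite F" "F \<subseteq> I"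
  shows "T (l2_proj F c) = (\<Sum>i\<in>F. scl (c i) (f i))"
  using \<open>finite F\<close> \<open>F \<subseteq> I\<close>
proof (induction F)
  case empty
  have "(\<lambda>i. 0) \<in> l2 I" by (simp add: l2_def)
  \<comment> \<open>Homogeneity with the scalar 0 sends the zero family to the zero vector.\<close>
  then have "T (\<lambda>i. 0 * 0) = scl 0 (T (\<lambda>i. 0))"
    by (rule synthesis_operatorD(2)[OF T])
  then show ?case by (simp add: l2_proj_def)
next
  case (insert i F)
  have 1: "l2_proj F c \<in> l2 I"
    using l2_mono[OF _ l2_proj_mem[OF \<open>c \<in> l2 I\<close>]] by blast
  have i: "i \<in> I" "l2_unit i \<in> l2 I" using insert l2_unit_mem by auto
  \<comment> \<open>The multiple of \<open>l2_unit i\<close> is recognised as a coordinate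
    projection of \<open>c\<close>, which places it in \<open>l2 I\<close>.\<close>
  have "l2_proj {i} c \<in> l2 I"
    using l2_mono[OF _ l2_proj_mem[OF \<open>c \<in> l2 I\<close>]] by blast
  moreover have "l2_proj {i} c = (\<lambda>j. c i * l2_unit i j)"
    by (auto simp: l2_proj_def l2_unit_def)
  ultimately have 2: "(\<lambda>j. c i * l2_unit i j) \<in> l2 I" by simp
  have "T (l2_proj (insert i F) c) = T (l2_proj F c) + T (\<lambda>j. c i * l2_unit i j)"
    unfolding l2_proj_insert[OF \<open>i \<notin> F\<close>] using 1 2 by (rule synthesis_operatorD(1)[OF T])
  also have "T (\<lambda>j. c i * l2_unit i j) = scl (c i) (T (l2_unit i))"
    using i(2) by (rule synthesis_operatorD(2)[OF T])
  also have "T (l2_unit i) = f i"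
    using i(1) by (rule synthesis_operatorD(4)[OF T])
  finally show ?case using insert by (simp add: add.commute)
qed

text \<open>The error of a finite sum is \<open>T\<close> applied to the remaining tail of
  \<open>c\<close>. The tail is small in the norm of \<open>l2 I\<close>, and \<open>T\<close> is
  bounded.\<close>

lemma synthesis_operator_approx:
  assumes T: "synthesis_operator I f T" and "K \<subseteq> I" and c: "c \<in> l2 K" and "e > 0"
  obtains F where "finite F" "F \<subseteq> K" "knorm (T c - (\<Sum>i\<in>F. scl (c i) (f i))) < e"
proof -
  have cI: "c \<in> l2 I" using l2_mono assms by blast
  obtain C where C: "\<And>d. d \<in> l2 I \<Longrightarrow> knorm (T d) \<le> C * l2_norm I d"
    using synthesis_operatorD(3)[OF T] by blast
  \<comment> \<open>The bound \<open>C\<close> carries no sign condition;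
    \<open>\<bar>C\<bar> + 1\<close> is positive and dominates it. The squared norm of the tail is
    then made at most \<open>r\<^sup>2\<close>.\<close>
  define r where "r = e / (\<bar>C\<bar> + 1)"
  have r: "r > 0" using \<open>e > 0\<close> by (simp add: r_def)
  obtain F where F: "finite F" "F \<subseteq> K"
    and "dist (\<Sum>i\<in>F. (cmod (c i))\<^sup>2) (\<Sum>\<^sub>\<infinity>i\<in>K. (cmod (c i))\<^sup>2) \<le> r\<^sup>2"
    using infsum_finite_approximation[of "\<lambda>i. (cmod (c i))\<^sup>2" K "r\<^sup>2"] c r by (auto simp: l2_def)
  then have "(l2_norm I (l2_proj (- F) c))\<^sup>2 \<le> r\<^sup>2"
    unfolding l2_norm_cofinite_proj[OF \<open>K \<subseteq> I\<close> c F] by (simp add: dist_real_def)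
  then have small: "l2_norm I (l2_proj (- F) c) \<le> r"
    using r less_imp_le by (blast intro: power2_le_imp_le)
  have mem: "l2_proj F c \<in> l2 I" "l2_proj (- F) c \<in> l2 I"
    using l2_mono[OF _ l2_proj_mem[OF cI]] by blast+
  have "T (\<lambda>i. l2_proj F c i + l2_proj (- F) c i) = T (l2_proj F c) + T (l2_proj (- F) c)"
    using mem by (rule synthesis_operatorD(1)[OF T])
  moreover have "(\<lambda>i. l2_proj F c i + l2_proj (- F) c i) = c"
    by (auto simp: l2_proj_def)
  ultimately have "T c - (\<Sum>i\<in>F. scl (c i) (f i)) = T (l2_proj (- F) c)"
    using synthesis_operator_finite[OF T cI, of F] F \<open>K \<subseteq> I\<close> by simp
  then have "knorm (T c - (\<Sum>i\<in>F. scl (c i) (f i))) \<le> C * l2_norm I (l2_proj (- F) c)"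
    using C[OF mem(2)] by simp
  also have "\<dots> \<le> \<bar>C\<bar> * r"
    using small by (intro mult_mono) auto
  also have "\<dots> < (\<bar>C\<bar> + 1) * r" using r by simp
  also have "\<dots> = e" by (simp add: r_def)
  finally show ?thesis using that F by blast
qed

text \<open>Every \<open>f i\<close> with \<open>i\<close> in \<open>K\<close> is the image of a
  unit vector, so the closed subspace \<open>R\<close> contains the closed span. Conversely,
  elements of \<open>R\<close> are limits of finite combinations by
  \<open>synthesis_operator_approx\<close>.\<close>

lemma closure_of_span_eq_synthesis_range:
  assumes T: "synthesis_operator I f T" and "K \<subseteq> I"
    and R: "R = (T \<circ> l2_proj K) ` l2 I" and "subspace R" and closed: "ktopology closure_of R = R"
  shows "ktopology closure_of (span (f ` K)) = R"
proof
  have "f i \<in> R" if "i \<in> K" for i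
  proof -
    have "l2_proj K (l2_unit i) = l2_unit i"
      using that by (auto simp: l2_proj_def l2_unit_def)
    moreover have "T (l2_unit i) = f i"
      using that \<open>K \<subseteq> I\<close> by (intro synthesis_operatorD(4)[OF T]) blast
    moreover have "l2_unit i \<in> l2 I" using that \<open>K \<subseteq> I\<close> by (intro l2_unit_mem) blast
    ultimately show ?thesis unfolding R by (metis comp_apply image_eqI)
  qed
  then have "span (f ` K) \<subseteq> R" using \<open>subspace R\<close> by (intro span_minimal) auto
  then show "ktopology closure_of (span (f ` K)) \<subseteq> R"
    using closure_of_mono[of _ R ktopology] closed by auto
  show "R \<subseteq> ktopology closure_of (span (f ` K))"
  proof
    fix x assume "x \<in> R"
    then obtain c where c: "c \<in> l2 I" and x: "x = T (l2_proj K c)" by (auto simp: R)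
    have cK: "l2_proj K c \<in> l2 K" using l2_proj_mem[OF c, of K] \<open>K \<subseteq> I\<close> by (simp add: Int_absorb2)
    show "x \<in> ktopology closure_of (span (f ` K))"
      unfolding in_ktopology_closure_of
    proof (intro allI impI)
      fix e :: real assume "e > 0"
      then obtain F where "F \<subseteq> K" and F: "knorm (x - (\<Sum>i\<in>F. scl (l2_proj K c i) (f i))) < e"
        using synthesis_operator_approx[OF T \<open>K \<subseteq> I\<close> cK] x by metis
      have "(\<Sum>i\<in>F. scl (l2_proj K c i) (f i)) \<in> span (f ` K)"
        using \<open>F \<subseteq> K\<close> by (intro span_sum span_scale span_base) auto
      then show "\<exists>y\<in>span (f ` K). knorm (y - x) < e"
        using F unfolding K.form_norm_diff_commute[of x] by blast
    qed
  qed
qed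

text \<open>Formally this is Cauchy--Schwarz for the expansion of \<open>bracket x (T c)\<close> in
  the numbers \<open>bracket x (f i)\<close>. It is carried out on finite sums, whose bound does not
  depend on the chosen finite set, and the remainder costs an arbitrarily small
  \<open>e\<close>.\<close>

lemma bracket_synthesis_le:
  assumes T: "synthesis_operator I f T" and "K \<subseteq> I" and c: "c \<in> l2 K"
    and summable: "(\<lambda>i. (cmod (bracket x (f i)))\<^sup>2) summable_on K"
  shows "cmod (bracket x (T c)) \<le> l2_norm K c * sqrt (\<Sum>\<^sub>\<infinity>i\<in>K. (cmod (bracket x (f i)))\<^sup>2)"
    (is "_ \<le> ?b")
proof (rule field_le_epsilon)
  fix e :: real assume e: "e > 0"
  \<comment> \<open>Replacing \<open>T c\<close> by a finite sum within \<open>r\<close> changes its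
    bracket with \<open>x\<close> by at most \<open>e\<close>.\<close>
  define r where "r = e / (knorm x + 1)"
  have pos: "knorm x + 1 > 0" using K.form_norm_nonneg[of x] by linarith
  then have r: "r > 0" using e by (simp add: r_def)
  obtain F where F: "finite F" "F \<subseteq> K" and approx: "knorm (T c - (\<Sum>i\<in>F. scl (c i) (f i))) < r"
    using synthesis_operator_approx[OF T \<open>K \<subseteq> I\<close> c r] by blast
  let ?y = "\<Sum>i\<in>F. scl (c i) (f i)"
  have "cmod (bracket x ?y) = cmod (\<Sum>i\<in>F. cnj (c i) * bracket x (f i))"
    by (simp add: P.form_sum_right bracket_scale_right)
  also have "\<dots> \<le> (\<Sum>i\<in>F. \<bar>cmod (c i)\<bar> * \<bar>cmod (bracket x (f i))\<bar>)"
    by (rule order_trans[OF norm_sum]) (simp add: norm_mult)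
  also have "\<dots> \<le> L2_set (\<lambda>i. cmod (c i)) F * L2_set (\<lambda>i. cmod (bracket x (f i))) F"
    by (rule L2_set_mult_ineq)
  also have "\<dots> \<le> ?b"
    unfolding L2_set_def l2_norm_def
    by (intro mult_mono real_sqrt_le_mono finite_sum_le_infsum F summable)
      (use c in \<open>auto simp: l2_def infsum_nonneg sum_nonneg\<close>)
  finally have 1: "cmod (bracket x ?y) \<le> ?b" .
  have "cmod (bracket x (T c - ?y)) \<le> knorm x * knorm (T c - ?y)" by (rule bracket_le_knorm)
  also have "\<dots> \<le> (knorm x + 1) * r"
    using approx by (intro mult_mono) auto
  also have "\<dots> = e" using pos by (simp add: r_def)
  finally have 2: "cmod (bracket x (T c - ?y)) \<le> e" .
  have "bracket x (T c) = bracket x ?y + bracket x (T c - ?y)"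
    by (simp add: P.form_diff_right)
  then show "cmod (bracket x (T c)) \<le> ?b + e"
    using norm_triangle_ineq[of "bracket x ?y" "bracket x (T c - ?y)"] 1 2 by simp
qed

text \<open>By \<open>bracket_eq_kinner\<close> the numbers \<open>bracket x (f i)\<close> are the
  Bessel coefficients of the image of \<open>x\<close> under the fundamental symmetry, and that
  image has the same norm as \<open>x\<close>.\<close>

lemma bessel_family_bracket:
  assumes "bessel_family I f" "K \<subseteq> I"
  obtains B where "B > 0"
    "\<And>x. (\<lambda>i. (cmod (bracket x (f i)))\<^sup>2) summable_on K"
    "\<And>x. (\<Sum>\<^sub>\<infinity>i\<in>K. (cmod (bracket x (f i)))\<^sup>2) \<le> B * (knorm x)\<^sup>2"
proof -
  obtain B where sI: "\<And>x. (\<lambda>i. (cmod (kinner x (f i)))\<^sup>2) summable_on I"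
    and B: "\<And>x. (\<Sum>\<^sub>\<infinity>i\<in>I. (cmod (kinner x (f i)))\<^sup>2) \<le> B * (knorm x)\<^sup>2"
    using assms(1) unfolding bessel_family_def by blast
  have sK: "(\<lambda>i. (cmod (kinner x (f i)))\<^sup>2) summable_on K" for x
    using sI assms(2) by (rule summable_on_subset_banach)
  \<comment> \<open>Passing to \<open>\<bar>B\<bar> + 1\<close> makes the constant strictly
    positive.\<close>
  have "(\<Sum>\<^sub>\<infinity>i\<in>K. (cmod (kinner x (f i)))\<^sup>2) \<le> (\<bar>B\<bar> + 1) * (knorm x)\<^sup>2" for x
  proof -
    have "(\<Sum>\<^sub>\<infinity>i\<in>K. (cmod (kinner x (f i)))\<^sup>2) \<le> (\<Sum>\<^sub>\<infinity>i\<in>I. (cmod (kinner x (f i)))\<^sup>2)"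
      using sK sI assms(2) by (intro infsum_mono_neutral) auto
    also have "\<dots> \<le> B * (knorm x)\<^sup>2" by (rule B)
    also have "\<dots> \<le> (\<bar>B\<bar> + 1) * (knorm x)\<^sup>2" by (intro mult_right_mono) auto
    finally show ?thesis .
  qed
  from this[of "fundamental_symmetry _"] sK[of "fundamental_symmetry _"] show ?thesis
    by (intro that[of "\<bar>B\<bar> + 1"]) (simp_all add: bracket_eq_kinner[symmetric] knorm_fundamental_symmetry)
qed

section \<open>The frame inequalities on a maximal uniformly J-positive range\<close>

text \<open>The index set \<open>K\<close> is left general so that the result serves both signs:
  once for the given form, and once for the negated form with the negative indices.\<close>

lemma frame_of_maximal_uniformly_J_positive:
  assumes bessel: "bessel_family I f" and T: "synthesis_operator I f T" and "K \<subseteq> I"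
    and maximal: "maximal_uniformly_J_positive ((T \<circ> l2_proj K) ` l2 I)"
  defines "M \<equiv> ktopology closure_of (span (f ` K))"
  shows "hilbert_on scl bracket M \<and>
    (\<exists>A B. 0 < A \<and> A \<le> B \<and>
      (\<forall>x\<in>M. (\<lambda>i. (cmod (bracket x (f i)))\<^sup>2) summable_on K \<and>
        A * Re (bracket x x) \<le> (\<Sum>\<^sub>\<infinity>i\<in>K. (cmod (bracket x (f i)))\<^sup>2) \<and>
        (\<Sum>\<^sub>\<infinity>i\<in>K. (cmod (bracket x (f i)))\<^sup>2) \<le> B * Re (bracket x x)))"
proof -
  define s where "s x = (\<Sum>\<^sub>\<infinity>i\<in>K. (cmod (bracket x (f i)))\<^sup>2)" for x
  have s_nonneg: "0 \<le> s x" for x by (simp add: s_def infsum_nonneg)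
  have uniform: "uniformly_J_positive ((T \<circ> l2_proj K) ` l2 I)"
    using maximal by (simp add: maximal_uniformly_J_positive_def)
  have M: "M = (T \<circ> l2_proj K) ` l2 I"
    unfolding M_def
    by (rule closure_of_span_eq_synthesis_range[OF T \<open>K \<subseteq> I\<close> refl _
          maximal_uniformly_J_positive_closed[OF maximal]])
      (use uniform in \<open>simp add: uniformly_J_positive_def\<close>)
  have hilbert: "hilbert_on scl bracket M"
    unfolding M by (rule hilbert_on_uniformly_J_positive[OF uniform
          maximal_uniformly_J_positive_closed[OF maximal]])
  interpret M: inner_product_subspace scl bracket M
    using hilbert by unfold_locales (simp add: hilbert_on_def)
  obtain \<alpha> where \<alpha>: "\<alpha> > 0" and pos: "\<And>x. x \<in> M \<Longrightarrow> \<alpha> * (knorm x)\<^sup>2 \<le> Re (bracket x x)"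
    using uniform unfolding uniformly_J_positive_def M[symmetric] by blast
  obtain B where B: "B > 0"
    and summable: "\<And>x. (\<lambda>i. (cmod (bracket x (f i)))\<^sup>2) summable_on K"
    and upper: "\<And>x. s x \<le> B * (knorm x)\<^sup>2"
    using bessel_family_bracket[OF bessel \<open>K \<subseteq> I\<close>] unfolding s_def by blast

  \<comment> \<open>Because \<open>T\<close> maps \<open>l2 K\<close> onto \<open>M\<close>, each
    \<open>z\<close> has a coefficient family, and the norm of that family bounds the bracket with
    every \<open>y\<close> satisfying \<open>s y \<le> 1\<close>. This is the pointwise bound
    required for uniform boundedness.\<close>
  have "\<exists>k. \<forall>y\<in>{y \<in> M. s y \<le> 1}. cmod (bracket z y) \<le> k" if zM: "z \<in> M" for z
  proof -
    obtain c where c: "c \<in> l2 I" and z: "z = T (l2_proj K c)" using zM by (auto simp: M)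
    have cK: "l2_proj K c \<in> l2 K" using l2_proj_mem[OF c, of K] \<open>K \<subseteq> I\<close> by (simp add: Int_absorb2)
    have "cmod (bracket z y) \<le> l2_norm K (l2_proj K c)" if "s y \<le> 1" for y
    proof -
      have "cmod (bracket z y) = cmod (bracket y z)"
        using bracket_commute[of z y] by simp
      also have "\<dots> \<le> l2_norm K (l2_proj K c) * sqrt (s y)"
        using bracket_synthesis_le[OF T \<open>K \<subseteq> I\<close> cK summable] by (simp add: z s_def)
      also have "\<dots> \<le> l2_norm K (l2_proj K c) * 1"
        using that by (intro mult_left_mono) auto
      finally show ?thesis by simp
    qed
    then show ?thesis by blast
  qed
  then obtain k where k: "\<And>y. \<lbrakk>y \<in> M; s y \<le> 1\<rbrakk> \<Longrightarrow> form_norm bracket y \<le> k"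
    using M.weakly_bounded_imp_bounded[of "{y \<in> M. s y \<le> 1}"] hilbert
    by (auto simp: hilbert_on_def)
  \<comment> \<open>The maximum with 1 makes \<open>C\<close> positive, so that dividing by it is
    possible.\<close>
  define C where "C = max k 1"
  have C: "C > 0" "\<And>y. \<lbrakk>y \<in> M; s y \<le> 1\<rbrakk> \<Longrightarrow> form_norm bracket y \<le> C"
    using k by (auto simp: C_def max_def intro: order_trans)
  have s_scale: "s (scl a x) = (cmod a)\<^sup>2 * s x" for a x
    by (simp add: s_def bracket_scale_left norm_mult power_mult_distrib infsum_cmult_right')
  have "form_norm bracket x \<le> C * sqrt (s x)" if x: "x \<in> M" for x
  proof (rule field_le_epsilon)
    fix e :: real assume e: "e > 0"
    \<comment> \<open>The bound on vectors with \<open>s y \<le> 1\<close> extends to all of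
      \<open>M\<close> by rescaling. At this point \<open>s x\<close> could still be 0, so
      \<open>x\<close> is divided by a number slightly above \<open>sqrt (s x)\<close>; the excess
      \<open>e / C\<close> contributes just \<open>e\<close> in the end.\<close>
    define t where "t = sqrt (s x) + e / C"
    have t: "t > 0" "sqrt (s x) \<le> t"
      using e C s_nonneg[of x] by (auto simp: t_def intro!: add_nonneg_pos)
    let ?y = "scl (of_real (1 / t)) x"
    have "s x \<le> t\<^sup>2"
      using power_mono[OF t(2), of 2] s_nonneg[of x] by simp
    then have "s ?y \<le> 1"
      using t by (simp add: s_scale norm_divide power_divide divide_simps)
    then have "form_norm bracket ?y \<le> C"
      using C(2) x subspace_scale[OF M.subspace_S] by blast
    then have "form_norm bracket x \<le> C * t"
      using t by (simp add: M.form_norm_scale norm_divide divide_simps)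
    also have "\<dots> = C * sqrt (s x) + e" using C by (simp add: t_def field_simps)
    finally show "form_norm bracket x \<le> C * sqrt (s x) + e" .
  qed
  then have lower: "Re (bracket x x) \<le> C\<^sup>2 * s x" if "x \<in> M" for x
    using power_mono[of "form_norm bracket x" "C * sqrt (s x)" 2] M.form_norm_sq[OF that] that s_nonneg[of x]
    by (simp add: power_mult_distrib)
  define A' where "A' = 1 / C\<^sup>2"
  \<comment> \<open>The maximum ensures \<open>A' \<le> B'\<close> also when \<open>M\<close> is
    trivial, where the two inequalities alone would not order the constants.\<close>
  define B' where "B' = max A' (B / \<alpha>)"
  have "A' * Re (bracket x x) \<le> s x" if "x \<in> M" for x
    using lower[OF that] C by (simp add: A'_def divide_simps mult.commute)
  moreover have "s x \<le> B' * Re (bracket x x)" if "x \<in> M" for x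
  proof -
    have "s x \<le> B / \<alpha> * (\<alpha> * (knorm x)\<^sup>2)" using upper[of x] \<alpha> by simp
    also have "\<dots> \<le> B / \<alpha> * Re (bracket x x)"
      using pos[OF that] \<alpha> B by (intro mult_left_mono) auto
    also have "\<dots> \<le> B' * Re (bracket x x)"
      using M.form_nonneg[OF that] by (intro mult_right_mono) (auto simp: B'_def)
    finally show ?thesis .
  qed
  moreover have "0 < A'" "A' \<le> B'" using C by (auto simp: A'_def B'_def)
  ultimately show ?thesis using hilbert summable unfolding s_def by blast
qed

end

section \<open>The Krein space with the negated form\<close>

lemma krein_space_swap:
  assumes "krein_space scl bracket Hpos Hneg"
  shows "krein_space scl (\<lambda>x y. - bracket x y) Hneg Hpos"
proof -
  interpret krein_space scl bracket Hpos Hneg by fact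
  show ?thesis
  proof
    show "hermitian_form scl (\<lambda>x y. - bracket x y)"
      using hilbert_neg by (simp add: hilbert_on_def inner_product_on_def)
    show "hilbert_on scl (\<lambda>x y. - bracket x y) Hneg" by (rule hilbert_neg)
    show "hilbert_on scl (\<lambda>x y. - (- bracket x y)) Hpos" using hilbert_pos by simp
    show "- bracket x y = 0" if "x \<in> Hneg" "y \<in> Hpos" for x y
      using bracket_orthogonal[OF that(2,1)] bracket_commute[of x y] by simp
    show "Hneg \<inter> Hpos = {0}" using direct by blast
    show "\<exists>p\<in>Hneg. \<exists>m\<in>Hpos. x = p + m" for x
      using decomposition[of x] by (metis add.commute)
  qed
qed

text \<open>Negating the form exchanges the positive and negative parts, and the two sign changes
  cancel in \<open>kinner\<close>. Norm, topology, Bessel families and synthesis operators are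
  therefore the same for both Krein spaces.\<close>

lemma kinner_swap:
  assumes "krein_space scl bracket Hpos Hneg"
  shows "krein_space.kinner (\<lambda>x y. - bracket x y) Hneg Hpos = krein_space.kinner bracket Hpos Hneg"
proof -
  interpret krein_space scl bracket Hpos Hneg by fact
  interpret s: krein_space scl "\<lambda>x y. - bracket x y" Hneg Hpos
    by (rule krein_space_swap) fact
  have "s.part_pos x = part_neg x" "s.part_neg x = part_pos x" for x
    using s.part_pos_eq[OF part_neg_mem part_pos_mem, of x x]
      s.part_neg_eq[OF part_neg_mem part_pos_mem, of x x] part_sum[of x]
    by (simp_all add: add.commute)
  then show ?thesis by (simp add: fun_eq_iff kinner_def s.kinner_def)
qed

section \<open>Frame inequalities for both signs\<close>

theorem proposition3p2:
  fixes scl :: "complex \<Rightarrow> 'h::ab_group_add \<Rightarrow> 'h"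
    and bracket :: "'h \<Rightarrow> 'h \<Rightarrow> complex"
    and Hpos Hneg :: "'h set"
    and I :: "'i set"
    and f :: "'i \<Rightarrow> 'h"
  defines "I\<^sub>p \<equiv> krein_space.I_pos bracket I f"
    and "I\<^sub>n \<equiv> krein_space.I_neg bracket I f"
    and "M\<^sub>p \<equiv> krein_space.M_pos scl bracket Hpos Hneg I f"
    and "M\<^sub>n \<equiv> krein_space.M_neg scl bracket Hpos Hneg I f"
  assumes "separable_krein_space scl bracket Hpos Hneg"
    and "krein_space.J_frame scl bracket Hpos Hneg I f"
  shows "hilbert_on scl bracket M\<^sub>p \<and> hilbert_on scl (\<lambda>x y. - bracket x y) M\<^sub>n \<and>
    (\<exists>A\<^sub>p B\<^sub>p A\<^sub>n B\<^sub>n :: real. B\<^sub>n \<le> A\<^sub>n \<and> A\<^sub>n < 0 \<and> 0 < A\<^sub>p \<and> A\<^sub>p \<le> B\<^sub>p \<and>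
      (\<forall>x\<in>M\<^sub>p. (\<lambda>i. (cmod (bracket x (f i)))\<^sup>2) summable_on I\<^sub>p \<and>
        A\<^sub>p * Re (bracket x x) \<le> (\<Sum>\<^sub>\<infinity>i\<in>I\<^sub>p. (cmod (bracket x (f i)))\<^sup>2) \<and>
        (\<Sum>\<^sub>\<infinity>i\<in>I\<^sub>p. (cmod (bracket x (f i)))\<^sup>2) \<le> B\<^sub>p * Re (bracket x x)) \<and>
      (\<forall>x\<in>M\<^sub>n. (\<lambda>i. (cmod (bracket x (f i)))\<^sup>2) summable_on I\<^sub>n \<and>
        A\<^sub>n * Re (bracket x x) \<le> (\<Sum>\<^sub>\<infinity>i\<in>I\<^sub>n. (cmod (bracket x (f i)))\<^sup>2) \<and>
        (\<Sum>\<^sub>\<infinity>i\<in>I\<^sub>n. (cmod (bracket x (f i)))\<^sup>2) \<le> B\<^sub>n * Re (bracket x x)))"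
proof -
  have krein: "krein_space scl bracket Hpos Hneg"
    using assms(5) by (simp add: separable_krein_space_def)
  interpret krein_space scl bracket Hpos Hneg by (rule krein)
  interpret s: krein_space scl "\<lambda>x y. - bracket x y" Hneg Hpos
    by (rule krein_space_swap[OF krein])
  note swap = kinner_swap[OF krein]
  obtain T where bessel: "bessel_family I f" and T: "synthesis_operator I f T"
    and pos: "maximal_uniformly_J_positive ((T \<circ> l2_proj I\<^sub>p) ` l2 I)"
    and neg: "maximal_uniformly_J_negative ((T \<circ> l2_proj I\<^sub>n) ` l2 I)"
    using assms(6) unfolding J_frame_def I\<^sub>p_def I\<^sub>n_def by blast
  have subset: "I\<^sub>p \<subseteq> I" "I\<^sub>n \<subseteq> I"
    by (auto simp: I\<^sub>p_def I\<^sub>n_def I_pos_def I_neg_def)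
  \<comment> \<open>With equal norms, uniform negativity for \<open>bracket\<close> is uniform
    positivity for its negative, with the same \<alpha>; maximality carries over with it.\<close>
  have "s.uniformly_J_positive S \<longleftrightarrow> uniformly_J_negative S" for S
    unfolding s.uniformly_J_positive_def uniformly_J_negative_def swap by (simp add: le_minus_iff)
  then have neg': "s.maximal_uniformly_J_positive ((T \<circ> l2_proj I\<^sub>n) ` l2 I)"
    using neg by (simp add: s.maximal_uniformly_J_positive_def maximal_uniformly_J_negative_def)
  have bessel': "s.bessel_family I f"
    using bessel unfolding s.bessel_family_def bessel_family_def swap .
  have T': "s.synthesis_operator I f T"
    using T unfolding s.synthesis_operator_def synthesis_operator_def swap .
  have "s.ktopology = ktopology"
    unfolding s.ktopology_def ktopology_def swap ..
  then have M: "M\<^sub>p = ktopology closure_of (span (f ` I\<^sub>p))" "M\<^sub>n = s.ktopology closure_of (span (f ` I\<^sub>n))"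
    by (simp_all add: M\<^sub>p_def M\<^sub>n_def M_pos_def M_neg_def I\<^sub>p_def I\<^sub>n_def)
  obtain A B where p: "hilbert_on scl bracket M\<^sub>p" "0 < A" "A \<le> B"
    "\<forall>x\<in>M\<^sub>p. (\<lambda>i. (cmod (bracket x (f i)))\<^sup>2) summable_on I\<^sub>p \<and>
        A * Re (bracket x x) \<le> (\<Sum>\<^sub>\<infinity>i\<in>I\<^sub>p. (cmod (bracket x (f i)))\<^sup>2) \<and>
        (\<Sum>\<^sub>\<infinity>i\<in>I\<^sub>p. (cmod (bracket x (f i)))\<^sup>2) \<le> B * Re (bracket x x)"
    using frame_of_maximal_uniformly_J_positive[OF bessel T subset(1) pos] unfolding M by blast
  obtain A' B' where n: "hilbert_on scl (\<lambda>x y. - bracket x y) M\<^sub>n" "0 < A'" "A' \<le> B'"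
    "\<forall>x\<in>M\<^sub>n. (\<lambda>i. (cmod (- bracket x (f i)))\<^sup>2) summable_on I\<^sub>n \<and>
        A' * Re (- bracket x x) \<le> (\<Sum>\<^sub>\<infinity>i\<in>I\<^sub>n. (cmod (- bracket x (f i)))\<^sup>2) \<and>
        (\<Sum>\<^sub>\<infinity>i\<in>I\<^sub>n. (cmod (- bracket x (f i)))\<^sup>2) \<le> B' * Re (- bracket x x)"
    using s.frame_of_maximal_uniformly_J_positive[OF bessel' T' subset(2) neg'] unfolding M by blast
  \<comment> \<open>The minus sign of the form is moved onto the constants: \<open>- A'\<close> and
    \<open>- B'\<close> are the negative frame bounds, in reversed order.\<close>
  have "\<forall>x\<in>M\<^sub>n. (\<lambda>i. (cmod (bracket x (f i)))\<^sup>2) summable_on I\<^sub>n \<and>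
        - A' * Re (bracket x x) \<le> (\<Sum>\<^sub>\<infinity>i\<in>I\<^sub>n. (cmod (bracket x (f i)))\<^sup>2) \<and>
        (\<Sum>\<^sub>\<infinity>i\<in>I\<^sub>n. (cmod (bracket x (f i)))\<^sup>2) \<le> - B' * Re (bracket x x)"
    using n(4) by simp
  moreover have "- B' \<le> - A'" "- A' < 0" using n(2,3) by simp_all
  ultimately show ?thesis
    using p n(1) by blast
qed

end
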